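(* Let $\alpha>0$, let $\nu$ be a symmetric probability measure on $\mathbb{R}$ with distribution function $F$ satisfying $F(0)=\frac12$, and let $\{X_n: n\in\mathbb{N}_0\}$ be the Kendall random walk with parameter $\alpha$ and step distribution $\nu$ (so $X_1\sim F$). Let $\tau_0^+=\min\{n\geqslant 1: X_n>0\}$. Then for all $s\in[0,1]$ and $u>0$, $$ \mathbf{E}\, s^{\tau_0^+}\Psi\left(uX_{\tau_0^+}\right) = \frac{\frac{s}{2}}{1-\frac{s}{2}}\cdot\frac{(1-\frac{s}{2})\,G(1/u)}{1-\frac{s}{2}G(1/u)} = \mathbf{E}\, s^{\tau_0^+}\;\mathbf{E}\,\Psi\left(uZ_{s/2}\right), $$ where $Z_{s/2}$ is the geometric-Kendall random variable associated with the walk.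
   Context: Fix $\alpha>0$. Notation: $\Psi(t)=(1-|t|^\alpha)_+$, where $a_+=\max\{a,0\}$; $F(t)=\nu((-\infty,t))$; $G(t)=\int_{\mathbb{R}}\Psi(x/t)\,\nu(dx)$ for $t>0$. For $a\neq0$, $(T_a\lambda)(A)=\lambda(A/a)$, and $T_0\lambda=\delta_0$. Put $\widetilde{\delta}_x=\frac12\delta_x+\frac12\delta_{-x}$ and let $\widetilde{\pi}_{2\alpha}(dy)=\alpha|y|^{-2\alpha-1}\mathbf{1}_{[1,\infty)}(|y|)\,dy$ (symmetric Pareto distribution). Kendall convolution: for $x,y\in\mathbb{R}$ let $M=\max\{|x|,|y|\}$, $m=\min\{|x|,|y|\}$, $\varrho=m/M$, and $$\delta_x\vartriangle_\alpha\delta_y=\widetilde{\delta}_x\vartriangle_\alpha\widetilde{\delta}_y:=T_M\left(\varrho^\alpha\widetilde{\pi}_{2\alpha}+(1-\varrho^\alpha)\widetilde{\delta}_1\right)$$ (equal to $\delta_0$ if $x=y=0$); for probability measures, $(\nu_1\vartriangle_\alpha\nu_2)(A)=\int_{\mathbb{R}^2}(\delta_x\vartriangle_\alpha\delta_y)(A)\,\nu_1(dx)\nu_2(dy)$. $\nu^{\vartriangle_\alpha n}$ denotes the $n$-fold Kendall convolution of $\nu$. The Kendall random walk with step distribution $\nu$ (symmetric) is the time-homogeneous Markov process $\{X_n:n\in\mathbb{N}_0\}$ on $\mathbb{R}$ with $X_0\equiv0$ and transition probabilities $P_n(x,A)=\mathbf{P}\{X_{n+k}\in A\mid X_k=x\}=(\delta_x\vartriangle_\alpha\nu^{\vartriangle_\alpha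 n})(A)$; in particular $X_1\sim\nu$. The convention is $\min\emptyset=\infty$. Geometric-Kendall random variable: for $0\leqslant s\leqslant1$ let $N_{s/2}$ be independent of the walk with $\mathbf{P}\{N_{s/2}=k\}=(\frac s2)^{k-1}(1-\frac s2)$, $k=1,2,\dots$ (with $0^0=1$), and $Z_{s/2}=\sum_{k=1}^\infty X_k\mathbf{1}_{\{N_{s/2}=k\}}$. *)

theory Defs
  imports "HOL-Probability.Probability" "HOL-Library.Extended_Nat"
begin

section \<open>Kendall convolution\<close>

definition symmetric_law :: "real measure \<Rightarrow> bool" where
  "symmetric_law \<nu> \<longleftrightarrow> prob_space \<nu> \<and> sets \<nu> = sets borel \<and> distr \<nu> borel uminus = \<nu>"

definition Psi :: "real \<Rightarrow> real \<Rightarrow> real" where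
  "Psi \<alpha> t = max 0 (1 - \<bar>t\<bar> powr \<alpha>)"

definition G_fun :: "real \<Rightarrow> real measure \<Rightarrow> real \<Rightarrow> real" where
  "G_fun \<alpha> \<nu> t = (LINT x|\<nu>. Psi \<alpha> (x / t))"

(* For a \<noteq> 0 this is A \<mapsto> \<mu>(A / a); for a = 0 and a probability measure it is the point mass at 0. *)
definition rescale :: "real \<Rightarrow> real measure \<Rightarrow> real measure" where
  "rescale a \<mu> = distr \<mu> borel (\<lambda>x. a * x)"

definition mixture :: "real \<Rightarrow> real measure \<Rightarrow> real measure \<Rightarrow> real measure" where
  "mixture p \<mu> \<nu> = measure_of UNIV (sets borel)
     (\<lambda>A. ennreal p * emeasure \<mu> A + ennreal (1 - p) * emeasure \<nu> A)"

definition sym_dirac :: "real \<Rightarrow> real measure" where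
  "sym_dirac x = mixture (1/2) (return borel x) (return borel (- x))"

(* The symmetric Pareto law with tail index 2\<alpha>; the parameter is \<alpha>. *)
definition sym_pareto :: "real \<Rightarrow> real measure" where
  "sym_pareto \<alpha> = density lborel
     (\<lambda>y. ennreal (\<alpha> * \<bar>y\<bar> powr (- 2 * \<alpha> - 1) * indicator {1..} \<bar>y\<bar>))"

(* For x = y = 0 we have b = 0, so the result is the point mass at 0
   (the value \<rho> = 0 / 0 = 0 is irrelevant). *)
definition kendall_kernel :: "real \<Rightarrow> real \<Rightarrow> real \<Rightarrow> real measure" where
  "kendall_kernel \<alpha> x y =
     (let b = max \<bar>x\<bar> \<bar>y\<bar>; m = min \<bar>x\<bar> \<bar>y\<bar>; \<rho> = m / b
      in rescale b (mixture (\<rho> powr \<alpha>) (sym_pareto \<alpha>) (sym_dirac 1)))"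

definition kendall_conv :: "real \<Rightarrow> real measure \<Rightarrow> real measure \<Rightarrow> real measure" where
  "kendall_conv \<alpha> \<mu> \<nu> = (\<mu> \<Otimes>\<^sub>M \<nu>) \<bind> (\<lambda>(x, y). kendall_kernel \<alpha> x y)"

fun kendall_power :: "real \<Rightarrow> real measure \<Rightarrow> nat \<Rightarrow> real measure" where
  "kendall_power \<alpha> \<nu> 0 = return borel 0"
| "kendall_power \<alpha> \<nu> (Suc 0) = \<nu>"
| "kendall_power \<alpha> \<nu> (Suc (Suc n)) = kendall_conv \<alpha> (kendall_power \<alpha> \<nu> (Suc n)) \<nu>"


section \<open>The Kendall convolution is well defined\<close>

text \<open>
  \<^const>\<open>measure_of\<close> and \<^const>\<open>bind\<close> return default values if their arguments are not
  a measure or not a measurable kernel. The lemmas of this section exclude that case.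
\<close>

lemma mixture_simps [simp]:
  "sets (mixture p \<mu> \<nu>) = sets borel" "space (mixture p \<mu> \<nu>) = UNIV"
  unfolding mixture_def
   apply (metis sets.sets_measure_of_eq space_borel)
  apply (simp add: space_measure_of_conv)
  done

lemma emeasure_mixture:
  assumes "sets \<mu> = sets borel" "sets \<nu> = sets borel" "A \<in> sets borel"
  shows "emeasure (mixture p \<mu> \<nu>) A = ennreal p * emeasure \<mu> A + ennreal (1 - p) * emeasure \<nu> A"
proof (rule emeasure_measure_of[OF mixture_def])
  show "sets borel \<subseteq> Pow (UNIV :: real set)" "A \<in> sets (mixture p \<mu> \<nu>)"
    using assms by auto
  show "positive (sets (mixture p \<mu> \<nu>))
      (\<lambda>A. ennreal p * emeasure \<mu> A + ennreal (1 - p) * emeasure \<nu> A)"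
    by (auto simp: positive_def)
  show "countably_additive (sets (mixture p \<mu> \<nu>))
      (\<lambda>A. ennreal p * emeasure \<mu> A + ennreal (1 - p) * emeasure \<nu> A)"
  proof (rule countably_additiveI)
    fix B :: "nat \<Rightarrow> real set"
    assume B: "range B \<subseteq> sets (mixture p \<mu> \<nu>)" "disjoint_family B"
    have 1: "(\<Sum>i. emeasure \<mu> (B i)) = emeasure \<mu> (\<Union>i. B i)"
      using B assms by (intro suminf_emeasure) auto
    have 2: "(\<Sum>i. emeasure \<nu> (B i)) = emeasure \<nu> (\<Union>i. B i)"
      using B assms by (intro suminf_emeasure) auto
    show "(\<Sum>i. ennreal p * emeasure \<mu> (B i) + ennreal (1 - p) * emeasure \<nu> (B i)) =
        ennreal p * emeasure \<mu> (\<Union>i. B i) + ennreal (1 - p) * emeasure \<nu> (\<Union>i. B i)"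
      by (simp add: suminf_add[symmetric] 1 2)
  qed
qed

lemma prob_space_mixture:
  assumes "prob_space \<mu>" "prob_space \<nu>" "sets \<mu> = sets borel" "sets \<nu> = sets borel"
    "0 \<le> p" "p \<le> 1"
  shows "prob_space (mixture p \<mu> \<nu>)"
proof
  have "emeasure \<mu> UNIV = 1" "emeasure \<nu> UNIV = 1"
    using assms(1-4) by (metis prob_space.emeasure_space_1 sets_eq_imp_space_eq space_borel)+
  then show "emeasure (mixture p \<mu> \<nu>) (space (mixture p \<mu> \<nu>)) = 1"
    using assms by (simp add: emeasure_mixture flip: ennreal_plus)
qed

lemma prob_space_sym_dirac: "prob_space (sym_dirac x)" and sets_sym_dirac: "sets (sym_dirac x) = sets borel"
  unfolding sym_dirac_def by (auto intro!: prob_space_mixture prob_space_return)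

lemma sets_sym_pareto [simp]: "sets (sym_pareto \<alpha>) = sets borel"
  by (simp add: sym_pareto_def)

lemma prob_space_sym_pareto:
  assumes "\<alpha> > 0"
  shows "prob_space (sym_pareto \<alpha>)"
proof
  define f where "f = (\<lambda>y::real. \<alpha> * \<bar>y\<bar> powr (- 2 * \<alpha> - 1))"
  have pos: "(\<integral>\<^sup>+y. ennreal (f y) * indicator {1..} y \<partial>lborel) = ennreal (0 - (- 1 / 2))"
  proof -
    have "(\<integral>\<^sup>+y. ennreal (f y) * indicator {1..} y \<partial>lborel) = ennreal (0 - (- (1 powr (- 2 * \<alpha>)) / 2))"
    proof (rule nn_integral_FTC_atLeast[where F = "\<lambda>y. - (y powr (- 2 * \<alpha>)) / 2"])
      show "f \<in> borel_measurable borel" by (simp add: f_def)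
      show "((\<lambda>y. - (y powr (- 2 * \<alpha>)) / 2) has_real_derivative f x) (at x)" if "1 \<le> x" for x
        using that assms unfolding f_def
        by (auto intro!: derivative_eq_intros simp: field_simps powr_diff)
      show "0 \<le> f x" for x using assms by (simp add: f_def)
      show "((\<lambda>y. - (y powr (- 2 * \<alpha>)) / 2) \<longlongrightarrow> 0) at_top"
        using tendsto_divide[OF tendsto_minus[OF tendsto_neg_powr[OF _ filterlim_ident, of "- 2 * \<alpha>"]] tendsto_const[of 2]] assms
        by simp
    qed
    then show ?thesis by simp
  qed
  have neg: "(\<integral>\<^sup>+y. ennreal (f y) * indicator {..-1} y \<partial>lborel) =
      (\<integral>\<^sup>+y. ennreal (f y) * indicator {1..} y \<partial>lborel)"
    by (subst nn_integral_real_affine[where c = "-1" and t = 0])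
       (auto simp: f_def indicator_def intro!: nn_integral_cong)
  have "emeasure (sym_pareto \<alpha>) UNIV =
      (\<integral>\<^sup>+y. (ennreal (f y) * indicator {1..} y + ennreal (f y) * indicator {..-1} y) \<partial>lborel)"
    unfolding sym_pareto_def
    by (subst emeasure_density) (auto simp: f_def indicator_def intro!: nn_integral_cong)
  also have "\<dots> = ennreal (1/2) + ennreal (1/2)"
    by (subst nn_integral_add) (auto simp: pos neg, simp_all add: f_def)
  also have "\<dots> = ennreal (1/2 + 1/2)" by (rule ennreal_plus[symmetric]) auto
  also have "\<dots> = 1" by simp
  finally show "emeasure (sym_pareto \<alpha>) (space (sym_pareto \<alpha>)) = 1"
    by (simp add: sym_pareto_def)
qed

lemma kendall_kernel_measurable:
  assumes "\<alpha> > 0"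
  shows "(\<lambda>(x, y). kendall_kernel \<alpha> x y) \<in> borel \<Otimes>\<^sub>M borel \<rightarrow>\<^sub>M prob_algebra borel"
proof -
  let ?b = "\<lambda>z::real \<times> real. max \<bar>fst z\<bar> \<bar>snd z\<bar>"
  let ?r = "\<lambda>z::real \<times> real. (min \<bar>fst z\<bar> \<bar>snd z\<bar> / ?b z) powr \<alpha>"
  let ?m = "\<lambda>z. mixture (?r z) (sym_pareto \<alpha>) (sym_dirac 1)"
  have r: "0 \<le> ?r z" "?r z \<le> 1" for z
    using assms by (auto intro!: powr_le1 simp: divide_simps)
  have prob: "prob_space (?m z)" for z
    using assms r by (intro prob_space_mixture prob_space_sym_pareto prob_space_sym_dirac)
      (auto simp: sets_sym_dirac)
  have m: "?m \<in> borel \<Otimes>\<^sub>M borel \<rightarrow>\<^sub>M subprob_algebra borel"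
  proof (rule measurable_subprob_algebra)
    fix z show "subprob_space (?m z)" using prob by (rule prob_space_imp_subprob_space)
  next
    fix A :: "real set" assume "A \<in> sets borel"
    then have "(\<lambda>z. emeasure (?m z) A) = (\<lambda>z. ennreal (?r z) * emeasure (sym_pareto \<alpha>) A
        + ennreal (1 - ?r z) * emeasure (sym_dirac 1) A)"
      by (auto simp: emeasure_mixture sets_sym_dirac)
    also have "\<dots> \<in> borel_measurable (borel \<Otimes>\<^sub>M borel)" by measurable
    finally show "(\<lambda>z. emeasure (?m z) A) \<in> borel_measurable (borel \<Otimes>\<^sub>M borel)" .
  qed simp
  have "(\<lambda>z. rescale (?b z) (?m z)) \<in> borel \<Otimes>\<^sub>M borel \<rightarrow>\<^sub>M subprob_algebra borel"
    unfolding rescale_def by (rule measurable_distr2[OF _ m]) measurable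
  moreover have "prob_space (rescale (?b z) (?m z))" for z
    unfolding rescale_def
    by (intro prob_space.prob_space_distr prob) (simp add: measurable_cong_sets[OF mixture_simps(1) refl])
  ultimately show ?thesis
    by (auto simp: measurable_prob_algebraI kendall_kernel_def Let_def case_prod_beta)
qed

lemma emeasure_kendall_conv:
  assumes "\<alpha> > 0" "sets \<mu> = sets borel" "sets \<nu> = sets borel" "A \<in> sets borel"
  shows "emeasure (kendall_conv \<alpha> \<mu> \<nu>) A =
    (\<integral>\<^sup>+(x, y). emeasure (kendall_kernel \<alpha> x y) A \<partial>(\<mu> \<Otimes>\<^sub>M \<nu>))"
proof -
  have "(\<lambda>(x, y). kendall_kernel \<alpha> x y) \<in> \<mu> \<Otimes>\<^sub>M \<nu> \<rightarrow>\<^sub>M subprob_algebra borel"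
    using measurable_prob_algebraD[OF kendall_kernel_measurable[OF assms(1)]] assms
    by (simp cong: measurable_cong_sets sets_pair_measure_cong)
  moreover have "space (\<mu> \<Otimes>\<^sub>M \<nu>) \<noteq> {}"
    using sets_eq_imp_space_eq[OF assms(2)] sets_eq_imp_space_eq[OF assms(3)]
    by (simp add: space_pair_measure)
  ultimately show ?thesis
    using assms by (simp add: kendall_conv_def emeasure_bind[where N = borel] case_prod_unfold)
qed


section \<open>The Kendall random walk\<close>

definition process_sigma :: "'w measure \<Rightarrow> (nat \<Rightarrow> 'w \<Rightarrow> real) \<Rightarrow> nat set \<Rightarrow> 'w measure" where
  "process_sigma M X I =
     sigma (space M) (\<Union>i\<in>I. {X i -` A \<inter> space M | A. A \<in> sets borel})"

(* The transition law is imposed for n \<ge> 1 only. The formula fails for n = 0: convolving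
   the point mass at x with the point mass at 0 gives sym_dirac x, not the point mass at x. *)
definition kendall_walk ::
    "real \<Rightarrow> real measure \<Rightarrow> 'w measure \<Rightarrow> (nat \<Rightarrow> 'w \<Rightarrow> real) \<Rightarrow> bool" where
  "kendall_walk \<alpha> \<nu> M X \<longleftrightarrow>
     prob_space M \<and>
     (\<forall>n. X n \<in> borel_measurable M) \<and>
     (\<forall>\<omega>\<in>space M. X 0 \<omega> = 0) \<and>
     (\<forall>k. \<forall>n\<ge>1. \<forall>A\<in>sets borel. AE \<omega> in M.
        real_cond_exp M (process_sigma M X {..k}) (indicator (X (n + k) -` A \<inter> space M)) \<omega> =
        measure (kendall_conv \<alpha> (return borel (X k \<omega>)) (kendall_power \<alpha> \<nu> n)) A)"

(* Inf {} = \<infinity> in enat; on non-empty sets Inf is the minimum. *)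
definition tau_plus :: "(nat \<Rightarrow> 'w \<Rightarrow> real) \<Rightarrow> 'w \<Rightarrow> enat" where
  "tau_plus X \<omega> = Inf {enat n | n. n \<ge> 1 \<and> X n \<omega> > 0}"

(* Expectations involving s ^ tau are taken over {tau < \<infinity>}, i.e. s ^ \<infinity> = 0, also for s = 1. *)
definition enat_pow :: "real \<Rightarrow> enat \<Rightarrow> real" where
  "enat_pow s t = (case t of enat n \<Rightarrow> s ^ n | \<infinity> \<Rightarrow> 0)"

(* The value on {tau = \<infinity>} is irrelevant: it is only used multiplied by s ^ \<infinity> = 0. *)
definition X_tau :: "(nat \<Rightarrow> 'w \<Rightarrow> real) \<Rightarrow> 'w \<Rightarrow> real" where
  "X_tau X \<omega> = (case tau_plus X \<omega> of enat n \<Rightarrow> X n \<omega> | \<infinity> \<Rightarrow> 0)"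

(* Geometric time with success probability 1 - q, independent of the whole walk. *)
definition geometric_time ::
    "real \<Rightarrow> 'w measure \<Rightarrow> (nat \<Rightarrow> 'w \<Rightarrow> real) \<Rightarrow> ('w \<Rightarrow> nat) \<Rightarrow> bool" where
  "geometric_time q M X N \<longleftrightarrow>
     N \<in> measurable M (count_space UNIV) \<and>
     (\<forall>k\<ge>1. measure M {\<omega>\<in>space M. N \<omega> = k} = q ^ (k - 1) * (1 - q)) \<and>
     prob_space.indep_set M (sets (vimage_algebra (space M) N (count_space UNIV)))
       (sets (process_sigma M X UNIV))"

definition geometric_kendall :: "(nat \<Rightarrow> 'w \<Rightarrow> real) \<Rightarrow> ('w \<Rightarrow> nat) \<Rightarrow> 'w \<Rightarrow> real" where
  "geometric_kendall X N \<omega> = (\<Sum>k. X (Suc k) \<omega> * of_bool (N \<omega> = Suc k))"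

end

theory Submission
  imports Defs
begin

text \<open>
  A kernel \<open>\<delta>\<^sub>x \<triangle> \<delta>\<^sub>y\<close> with \<open>y \<noteq> 0\<close> is symmetric without an atom at \<open>0\<close>, and \<open>\<Psi>(u \<cdot>)\<close> is a
  multiplicative functional of the Kendall convolution, so integrating \<open>\<Psi>(u \<cdot>)\<close> over either
  half-line gives \<open>\<Psi>(u x) \<Psi>(u y) / 2\<close>. Since \<open>\<nu>\<close> does not charge \<open>0\<close>, every step of the walk
  multiplies the expectation of \<open>\<Psi>(u X\<^sub>n)\<close> on \<open>{X\<^sub>1 \<le> 0, \<dots>, X\<^sub>n \<le> 0}\<close> by \<open>G(1/u) / 2\<close>, whatever
  the sign of the new position. Summing over the value of the ladder epoch leaves a geometric
  series; \<open>u = 0\<close> gives the generating function of the epoch.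
\<close>

section \<open>The function \<open>Psi\<close> and integrals against mixtures\<close>

lemma Psi_measurable [measurable]: "Psi \<alpha> \<in> borel_measurable borel"
  unfolding Psi_def[abs_def] by measurable

lemma Psi_nonneg [simp]: "0 \<le> Psi \<alpha> t"
  by (simp add: Psi_def)

lemma Psi_le_1: "Psi \<alpha> t \<le> 1"
  by (simp add: Psi_def)

lemma Psi_0 [simp]: "Psi \<alpha> 0 = 1"
  by (simp add: Psi_def)

lemma Psi_minus [simp]: "Psi \<alpha> (- t) = Psi \<alpha> t"
  by (simp add: Psi_def)

text \<open>\<open>mixture\<close> is given only by its values on Borel sets, so
  \<open>emeasure_mixture\<close> is the case of indicators; linearity and monotone limits carry it
  to all nonnegative Borel functions.\<close>

lemma nn_integral_mixture:
  assumes "sets \<mu> = sets borel" "sets \<nu> = sets borel" "f \<in> borel_measurable borel"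
  shows "(\<integral>\<^sup>+x. f x \<partial>mixture p \<mu> \<nu>) =
    ennreal p * (\<integral>\<^sup>+x. f x \<partial>\<mu>) + ennreal (1 - p) * (\<integral>\<^sup>+x. f x \<partial>\<nu>)"
  using assms(3)
proof (induction rule: borel_measurable_induct)
  have space: "space \<mu> = UNIV" "space \<nu> = UNIV"
    using assms(1,2)[THEN sets_eq_imp_space_eq] by auto
  {
    case (cong f g)
    then show ?case using space by (simp cong: nn_integral_cong)
  next
    case (set A)
    then show ?case using assms(1,2) by (simp add: emeasure_mixture)
  next
    case (mult u c)
    then show ?case using assms(1,2)
      by (simp add: nn_integral_cmult distrib_left mult_ac cong: measurable_cong_sets)
  next
    case (add u v)
    then show ?case using assms(1,2)
      by (simp add: nn_integral_add distrib_left add_ac cong: measurable_cong_sets)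
  next
    case (seq U)
    let ?I = "\<lambda>M i. \<integral>\<^sup>+x. U i x \<partial>M"
    have U: "U i \<in> borel_measurable \<mu>" "U i \<in> borel_measurable \<nu>"
        "U i \<in> borel_measurable (mixture p \<mu> \<nu>)" for i
      using seq(1) assms(1,2) by (simp_all cong: measurable_cong_sets)
    \<comment> \<open>Monotonicity is what allows the supremum of a sum to be split into the sum of
      the suprema.\<close>
    have mono: "incseq (?I \<mu>)" "incseq (?I \<nu>)"
      using seq(3) by (auto intro!: incseq_nn_integral)
    have "(\<integral>\<^sup>+x. (SUP i. U i) x \<partial>mixture p \<mu> \<nu>) = (SUP i. ?I (mixture p \<mu> \<nu>) i)"
      unfolding SUP_apply by (rule nn_integral_monotone_convergence_SUP[OF seq(3) U(3)])
    also have "\<dots> = (SUP i. ennreal p * ?I \<mu> i + ennreal (1 - p) * ?I \<nu> i)"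
      using seq.IH by simp
    also have "\<dots> = ennreal p * (SUP i. ?I \<mu> i) + ennreal (1 - p) * (SUP i. ?I \<nu> i)"
      unfolding SUP_mult_left_ennreal using mono
      by (intro ennreal_SUP_add) (auto simp: incseq_def intro!: mult_left_mono)
    also have "(SUP i. ?I \<mu> i) = (\<integral>\<^sup>+x. (SUP i. U i) x \<partial>\<mu>)"
      unfolding SUP_apply by (rule nn_integral_monotone_convergence_SUP[OF seq(3) U(1), symmetric])
    also have "(SUP i. ?I \<nu> i) = (\<integral>\<^sup>+x. (SUP i. U i) x \<partial>\<nu>)"
      unfolding SUP_apply by (rule nn_integral_monotone_convergence_SUP[OF seq(3) U(2), symmetric])
    finally show ?case .
  }
qed

section \<open>Half-line integrals of \<open>Psi\<close> against the Kendall kernel\<close>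

text \<open>For \<open>c > 0\<close> the factor \<open>Psi \<alpha> (c * y)\<close> cuts the
  integrand off at \<open>y = 1 / c\<close>. If \<open>1 \<le> c\<close>, nothing is left on
  \<open>{1..}\<close>; if \<open>0 < c < 1\<close>, an explicit antiderivative is evaluated on
  \<open>{1..1/c}\<close>. For \<open>c = 0\<close> there is no cutoff and the integral is the
  Pareto mass of a half-line; this case serves \<open>u = 0\<close> later.\<close>

lemma nn_integral_Psi_pareto_density:
  assumes "\<alpha> > 0" "0 \<le> c"
  shows "(\<integral>\<^sup>+y. ennreal (\<alpha> * y powr (- 2 * \<alpha> - 1) * Psi \<alpha> (c * y)) * indicator {1..} y \<partial>lborel)
    = ennreal ((Psi \<alpha> c)\<^sup>2 / 2)" (is "?L = _")
proof -
  consider "c = 0" | "0 < c" "c < 1" | "1 \<le> c" using assms by linarith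
  then show ?thesis
  proof cases
    case 1
    have "(\<integral>\<^sup>+y. ennreal (\<alpha> * y powr (- 2 * \<alpha> - 1)) * indicator {1..} y \<partial>lborel)
        = ennreal (0 - (- (1 powr (- 2 * \<alpha>)) / 2))"
    proof (rule nn_integral_FTC_atLeast[where F = "\<lambda>y. - (y powr (- 2 * \<alpha>)) / 2"])
      show "((\<lambda>y. - (y powr (- 2 * \<alpha>)) / 2) has_real_derivative \<alpha> * x powr (- 2 * \<alpha> - 1)) (at x)"
        if "1 \<le> x" for x
        using that assms by (auto intro!: derivative_eq_intros simp: field_simps powr_diff)
      show "((\<lambda>y. - (y powr (- 2 * \<alpha>)) / 2) \<longlongrightarrow> 0) at_top"
        using tendsto_divide[OF tendsto_minus[OF tendsto_neg_powr[OF _ filterlim_ident, of "- 2 * \<alpha>"]]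
            tendsto_const[of 2]] assms by simp
    qed (use assms in auto)
    then show ?thesis using 1 by simp
  next
    case 2
    define F where "F y = - (y powr (- 2 * \<alpha>)) / 2 + c powr \<alpha> * y powr (- \<alpha>)" for y :: real
    define f where "f y = \<alpha> * y powr (- 2 * \<alpha> - 1) * (1 - c powr \<alpha> * y powr \<alpha>)" for y :: real
    \<comment> \<open>This locates the point where the positive part in \<open>Psi\<close> becomes
      zero.\<close>
    have le1: "c powr \<alpha> * y powr \<alpha> \<le> 1 \<longleftrightarrow> y \<le> 1 / c" if "1 \<le> y" for y
    proof -
      have "(c * y) powr \<alpha> \<le> 1 \<longleftrightarrow> c * y \<le> 1"
      proof (cases "c * y \<le> 1")
        case True
        have "(c * y) powr \<alpha> \<le> 1" using that 2 assms True by (intro powr_le1) auto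
        with True show ?thesis by simp
      next
        case False
        then have "1 powr \<alpha> < (c * y) powr \<alpha>" using assms by (intro powr_less_mono2) auto
        then show ?thesis using False by simp
      qed
      moreover have "(c * y) powr \<alpha> = c powr \<alpha> * y powr \<alpha>" using that 2 by (simp add: powr_mult)
      ultimately show ?thesis using 2 by (simp add: field_simps)
    qed
    have "?L = (\<integral>\<^sup>+y. ennreal (f y) * indicator {1..1/c} y \<partial>lborel)"
    proof (rule nn_integral_cong)
      fix y :: real
      show "ennreal (\<alpha> * y powr (- 2 * \<alpha> - 1) * Psi \<alpha> (c * y)) * indicator {1..} y
          = ennreal (f y) * indicator {1..1/c} y"
        using le1[of y] 2 by (auto simp: f_def Psi_def powr_mult max_def abs_mult indicator_def)
    qed
    also have "\<dots> = ennreal (F (1/c) - F 1)"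
    proof (rule nn_integral_FTC_Icc)
      show "f \<in> borel_measurable borel" unfolding f_def[abs_def] by measurable
      show "1 \<le> 1 / c" using 2 by simp
      show "0 \<le> f x" if "x \<in> {1..1 / c}" for x
        using that le1[of x] assms by (auto simp: f_def)
      fix x :: real assume x: "x \<in> {1..1 / c}"
      have "x powr (- 2 * \<alpha> - 1) * x powr \<alpha> = x powr (- \<alpha> - 1)"
        by (simp flip: powr_add)
      then have "f x = \<alpha> * x powr (- 2 * \<alpha> - 1) - c powr \<alpha> * \<alpha> * x powr (- \<alpha> - 1)"
        by (simp add: f_def algebra_simps)
      then show "(F has_real_derivative f x) (at x)"
        using x unfolding F_def[abs_def]
        by (auto intro!: derivative_eq_intros)
    qed
    \<comment> \<open>With \<open>p = c powr \<alpha>\<close>, the values are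
      \<open>F (1/c) = p^2 / 2\<close> and \<open>F 1 = p - 1/2\<close>, and their difference is the
      perfect square \<open>(1 - p)^2 / 2\<close>.\<close>
    also have "F (1/c) - F 1 = (Psi \<alpha> c)\<^sup>2 / 2"
    proof -
      have "c powr (2 * \<alpha>) = (c powr \<alpha>)\<^sup>2"
        by (simp add: power2_eq_square flip: powr_add)
      moreover have "c powr \<alpha> \<le> 1" using 2 assms by (intro powr_le1) auto
      moreover have "(1/c) powr (- 2 * \<alpha>) = c powr (2 * \<alpha>)" "(1/c) powr (- \<alpha>) = c powr \<alpha>"
        using 2 by (simp_all add: powr_divide powr_minus_divide)
      ultimately show ?thesis using 2
        by (simp add: F_def Psi_def power2_eq_square algebra_simps)
    qed
    finally show ?thesis .
  next
    case 3
    have zero: "Psi \<alpha> (c * y) = 0" if "1 \<le> y" for y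
    proof -
      have "1 \<le> c * y" using mult_mono[OF 3 that] 3 by simp
      then show ?thesis using assms by (simp add: Psi_def ge_one_powr_ge_zero)
    qed
    have "?L = (\<integral>\<^sup>+y. 0 \<partial>(lborel :: real measure))"
      by (rule nn_integral_cong) (auto simp: zero indicator_def)
    moreover have "Psi \<alpha> c = 0" using 3 assms by (simp add: Psi_def ge_one_powr_ge_zero)
    ultimately show ?thesis by simp
  qed
qed

text \<open>Density and \<open>Psi\<close> are both even, so reflection maps the lower half-line to
  the upper one. The density vanishes near 0, so it does not matter which half-line contains
  0.\<close>

lemma nn_integral_Psi_sym_pareto_half:
  assumes "\<alpha> > 0" "0 \<le> c" "S = {0<..} \<or> S = {..0}"
  shows "(\<integral>\<^sup>+z. ennreal (Psi \<alpha> (c * z)) * indicator S z \<partial>sym_pareto \<alpha>) = ennreal ((Psi \<alpha> c)\<^sup>2 / 2)"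
proof -
  have [measurable]: "S \<in> sets borel" using assms(3) by auto
  let ?f = "\<lambda>z. ennreal (\<alpha> * \<bar>z\<bar> powr (- 2 * \<alpha> - 1) * indicator {1..} \<bar>z\<bar>) *
      (ennreal (Psi \<alpha> (c * z)) * indicator S z)"
  let ?h = "\<lambda>y. ennreal (\<alpha> * y powr (- 2 * \<alpha> - 1) * Psi \<alpha> (c * y)) * indicator {1..} y"
  have "(\<integral>\<^sup>+z. ennreal (Psi \<alpha> (c * z)) * indicator S z \<partial>sym_pareto \<alpha>) = (\<integral>\<^sup>+z. ?f z \<partial>lborel)"
    unfolding sym_pareto_def by (rule nn_integral_density) measurable
  also have "\<dots> = (\<integral>\<^sup>+y. ?h y \<partial>lborel)"
    using assms(3)
  proof
    assume "S = {0<..}"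
    then show ?thesis using assms(1)
      by (intro nn_integral_cong) (auto simp: indicator_def ennreal_mult')
  next
    assume S: "S = {..0}"
    have "(\<integral>\<^sup>+z. ?f z \<partial>lborel) = (\<integral>\<^sup>+z. ?f (- z) \<partial>lborel)"
      by (subst nn_integral_real_affine[where c = "-1" and t = 0]) auto
    also have "\<dots> = (\<integral>\<^sup>+y. ?h y \<partial>lborel)"
      using assms(1) S by (intro nn_integral_cong) (auto simp: indicator_def ennreal_mult')
    finally show ?thesis .
  qed
  also have "\<dots> = ennreal ((Psi \<alpha> c)\<^sup>2 / 2)"
    by (rule nn_integral_Psi_pareto_density[OF assms(1,2)])
  finally show ?thesis .
qed

text \<open>Write \<open>P\<close> for \<open>Psi \<alpha> (u * b)\<close>. The left side is
  \<open>P * (1 - r * (1 - P))\<close>. If \<open>P = 0\<close>, both sides vanish; otherwise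
  \<open>1 - P = (u * b) powr \<alpha>\<close>, and the choice of \<open>r\<close> turns
  \<open>r * (1 - P)\<close> into \<open>(u * m) powr \<alpha>\<close>, so the second factor is
  \<open>Psi \<alpha> (u * m)\<close>. Here \<open>y \<noteq> 0\<close> ensures
  \<open>b > 0\<close>.\<close>

lemma Psi_max_min:
  fixes x y u :: real
  assumes "\<alpha> > 0" "0 \<le> u" "y \<noteq> 0"
  defines "b \<equiv> max \<bar>x\<bar> \<bar>y\<bar>" and "m \<equiv> min \<bar>x\<bar> \<bar>y\<bar>"
  defines "r \<equiv> (m / b) powr \<alpha>"
  shows "r * (Psi \<alpha> (u * b))\<^sup>2 + (1 - r) * Psi \<alpha> (u * b) = Psi \<alpha> (u * x) * Psi \<alpha> (u * y)"
proof -
  have b: "b > 0" and m: "0 \<le> m" "m \<le> b" using assms(3) by (auto simp: b_def m_def)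
  have Psi: "Psi \<alpha> (u * x) * Psi \<alpha> (u * y) = Psi \<alpha> (u * b) * Psi \<alpha> (u * m)"
    using assms(2) by (auto simp: b_def m_def Psi_def abs_mult max_def min_def)
  have r: "r * (u * b) powr \<alpha> = (u * m) powr \<alpha>"
    using b m assms(2) by (simp add: r_def powr_divide powr_mult)
  show ?thesis
  proof (cases "(u * b) powr \<alpha> \<le> 1")
    case True
    have "(u * m) powr \<alpha> \<le> (u * b) powr \<alpha>"
      using m b assms(1,2) by (intro powr_mono2) (auto intro: mult_left_mono)
    then have eq: "Psi \<alpha> (u * m) = 1 - r * (u * b) powr \<alpha>" "Psi \<alpha> (u * b) = 1 - (u * b) powr \<alpha>"
      using True m b assms(2) by (auto simp: Psi_def r abs_mult)
    show ?thesis unfolding Psi eq by (simp add: power2_eq_square algebra_simps)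
  next
    case False
    then have "Psi \<alpha> (u * b) = 0" using b assms(2) by (simp add: Psi_def abs_mult)
    then show ?thesis unfolding Psi by simp
  qed
qed

text \<open>The Pareto part contributes half of the square in \<open>Psi_max_min\<close> and the
  two-point part half of the linear term. The condition \<open>y \<noteq> 0\<close> excludes the
  kernel at \<open>x = y = 0\<close>, a point mass at 0 that would lie entirely in
  \<open>{..0}\<close>.\<close>

lemma nn_integral_Psi_kendall_kernel_half:
  assumes "\<alpha> > 0" "0 \<le> u" "y \<noteq> 0" "S = {0<..} \<or> S = {..0}"
  shows "(\<integral>\<^sup>+z. ennreal (Psi \<alpha> (u * z)) * indicator S z \<partial>kendall_kernel \<alpha> x y)
    = ennreal (Psi \<alpha> (u * x) * Psi \<alpha> (u * y) / 2)"
proof -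
  have [measurable]: "S \<in> sets borel" using assms(4) by auto
  define b where "b = max \<bar>x\<bar> \<bar>y\<bar>"
  define r where "r = (min \<bar>x\<bar> \<bar>y\<bar> / b) powr \<alpha>"
  have b: "b > 0" using assms(3) by (auto simp: b_def)
  have r: "0 \<le> r" "r \<le> 1" using assms(1) b by (auto simp: r_def b_def intro!: powr_le1)
  let ?h = "\<lambda>z. ennreal (Psi \<alpha> ((u * b) * z)) * indicator S z"
  have "(\<integral>\<^sup>+z. ennreal (Psi \<alpha> (u * z)) * indicator S z \<partial>kendall_kernel \<alpha> x y)
      = (\<integral>\<^sup>+z. ennreal (Psi \<alpha> (u * (b * z))) * indicator S (b * z)
          \<partial>mixture r (sym_pareto \<alpha>) (sym_dirac 1))"
    unfolding kendall_kernel_def Let_def rescale_def b_def[symmetric] r_def[symmetric]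
    by (rule nn_integral_distr) (simp_all cong: measurable_cong_sets)
  \<comment> \<open>Multiplication by \<open>b > 0\<close> maps each half-line onto itself.\<close>
  also have "\<dots> = (\<integral>\<^sup>+z. ?h z \<partial>mixture r (sym_pareto \<alpha>) (sym_dirac 1))"
    using b assms(4)
    by (intro nn_integral_cong) (auto simp: indicator_def zero_less_mult_iff mult_le_0_iff mult.assoc)
  also have "\<dots> = ennreal r * (\<integral>\<^sup>+z. ?h z \<partial>sym_pareto \<alpha>) + ennreal (1 - r) * (\<integral>\<^sup>+z. ?h z \<partial>sym_dirac 1)"
    by (rule nn_integral_mixture) (auto simp: sets_sym_dirac)
  also have "(\<integral>\<^sup>+z. ?h z \<partial>sym_pareto \<alpha>) = ennreal ((Psi \<alpha> (u * b))\<^sup>2 / 2)"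
    using assms b by (intro nn_integral_Psi_sym_pareto_half) auto
  also have "(\<integral>\<^sup>+z. ?h z \<partial>sym_dirac 1) = ennreal (1/2) * ?h 1 + ennreal (1/2) * ?h (-1)"
    unfolding sym_dirac_def by (subst nn_integral_mixture) (auto simp: nn_integral_return)
  also have "\<dots> = ennreal (Psi \<alpha> (u * b) / 2)"
  proof -
    \<comment> \<open>Exactly one of the points 1 and -1 lies in \<open>S\<close>, and
      \<open>Psi\<close> takes the same value at both.\<close>
    have "ennreal (1/2) * ?h 1 + ennreal (1/2) * ?h (-1) = ennreal (1/2) * ennreal (Psi \<alpha> (u * b))"
      using assms(4) by auto
    then show ?thesis by (simp only: ennreal_mult'[symmetric]) simp
  qed
  also have "ennreal r * ennreal ((Psi \<alpha> (u * b))\<^sup>2 / 2) + ennreal (1 - r) * ennreal (Psi \<alpha> (u * b) / 2)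
      = ennreal ((r * (Psi \<alpha> (u * b))\<^sup>2 + (1 - r) * Psi \<alpha> (u * b)) / 2)"
    using r by (simp add: add_divide_distrib flip: ennreal_mult' ennreal_plus)
  also have "r * (Psi \<alpha> (u * b))\<^sup>2 + (1 - r) * Psi \<alpha> (u * b) = Psi \<alpha> (u * x) * Psi \<alpha> (u * y)"
    unfolding r_def b_def by (rule Psi_max_min[OF assms(1-3)])
  finally show ?thesis .
qed

section \<open>One step of the walk from a fixed position\<close>

text \<open>With a point mass as first factor, Fubini reduces the integral over the product to one
  over \<open>\<nu>\<close>. In this form the integral of a function is an iterated integral over
  \<open>\<nu>\<close> and the kernel.\<close>

lemma kendall_conv_return:
  assumes "\<alpha> > 0" "prob_space \<nu>" "sets \<nu> = sets borel"
  shows "kendall_conv \<alpha> (return borel x) \<nu> = \<nu> \<bind> kendall_kernel \<alpha> x"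
proof (rule measure_eqI)
  interpret prob_space \<nu> by fact
  note k [measurable] = measurable_prob_algebraD[OF kendall_kernel_measurable[OF assms(1)]]
  have [measurable_cong]: "sets \<nu> = sets borel" by fact
  have kx: "kendall_kernel \<alpha> x \<in> \<nu> \<rightarrow>\<^sub>M subprob_algebra borel"
    using measurable_compose[OF measurable_Pair1'[of x borel borel] k] assms(3)
    by (simp cong: measurable_cong_sets)
  have k2: "(\<lambda>z. kendall_kernel \<alpha> (fst z) (snd z)) \<in> return borel x \<Otimes>\<^sub>M \<nu> \<rightarrow>\<^sub>M subprob_algebra borel"
    using k by (simp add: case_prod_beta' cong: measurable_cong_sets)
  show sets: "sets (kendall_conv \<alpha> (return borel x) \<nu>) = sets (\<nu> \<bind> kendall_kernel \<alpha> x)"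
    unfolding kendall_conv_def case_prod_beta'
    using sets_bind[of "return borel x \<Otimes>\<^sub>M \<nu>" "\<lambda>z. kendall_kernel \<alpha> (fst z) (snd z)" borel]
      sets_bind[of \<nu> "kendall_kernel \<alpha> x" borel] sets_kernel[OF k2] sets_kernel[OF kx]
    by (simp add: space_pair_measure not_empty)
  fix A assume "A \<in> sets (kendall_conv \<alpha> (return borel x) \<nu>)"
  then have A [measurable]: "A \<in> sets borel"
    unfolding sets by (simp add: sets_bind[OF sets_kernel[OF kx]] not_empty)
  have m: "(\<lambda>z. emeasure (kendall_kernel \<alpha> (fst z) (snd z)) A) \<in> borel_measurable (return borel x \<Otimes>\<^sub>M \<nu>)"
    by (rule measurable_emeasure_kernel[OF k2 A])
  have "emeasure (kendall_conv \<alpha> (return borel x) \<nu>) A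
      = (\<integral>\<^sup>+a. \<integral>\<^sup>+y. emeasure (kendall_kernel \<alpha> a y) A \<partial>\<nu> \<partial>return borel x)"
    using assms A nn_integral_fst[OF m] by (simp add: emeasure_kendall_conv case_prod_beta')
  also have "\<dots> = (\<integral>\<^sup>+y. emeasure (kendall_kernel \<alpha> x y) A \<partial>\<nu>)"
    using borel_measurable_nn_integral_fst[OF m] by (subst nn_integral_return) auto
  also have "\<dots> = emeasure (\<nu> \<bind> kendall_kernel \<alpha> x) A"
    by (rule emeasure_bind[OF not_empty kx A, symmetric])
  finally show "emeasure (kendall_conv \<alpha> (return borel x) \<nu>) A = emeasure (\<nu> \<bind> kendall_kernel \<alpha> x) A" .
qed

text \<open>By symmetry \<open>{0<..}\<close> also has mass \<open>1 / 2\<close>, so the two open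
  half-lines exhaust the total mass. This is how F(0) = 1/2 enters the argument.\<close>

lemma AE_symmetric_law_nonzero:
  assumes "symmetric_law \<nu>" "measure \<nu> {..<0} = 1 / 2"
  shows "AE y in \<nu>. y \<noteq> 0"
proof -
  from assms(1) have "prob_space \<nu>" and s [measurable_cong]: "sets \<nu> = sets borel"
    and sym: "distr \<nu> borel uminus = \<nu>" by (auto simp: symmetric_law_def)
  then interpret prob_space \<nu> by simp
  have sp: "space \<nu> = UNIV" using sets_eq_imp_space_eq[OF s] by simp
  have "prob {0<..} = measure (distr \<nu> borel uminus) {0<..}" by (simp add: sym)
  also have "\<dots> = prob (uminus -` {0<..} \<inter> space \<nu>)" by (rule measure_distr) auto
  also have "uminus -` {0<..} \<inter> space \<nu> = {..<0::real}" by (auto simp: sp)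
  finally have pos: "prob {0<..} = 1 / 2" using assms(2) by simp
  have "prob ({..<0} \<union> {0<..}) = prob {..<0} + prob {0<..}"
    by (rule finite_measure_Union) (auto simp: s)
  then have "prob ({..<0} \<union> {0<..}) = 1" using pos assms(2) by simp
  then have "AE y in \<nu>. y \<in> {..<0} \<union> {0<..}"
    by (subst (asm) prob_eq_1) (auto simp: s)
  then show ?thesis by eventually_elim auto
qed

text \<open>For \<open>u = 0\<close> the conventions \<open>1 / 0 = 0\<close> and \<open>x / 0 = 0\<close>
  make both sides equal to the integral of \<open>1\<close>.\<close>

lemma G_fun_inverse: "G_fun \<alpha> \<nu> (1 / u) = (LINT x|\<nu>. Psi \<alpha> (u * x))"
  by (simp add: G_fun_def mult.commute)

text \<open>Being bounded by 1, \<open>Psi\<close> is integrable, so the Bochner integral in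
  \<open>G_fun\<close> is not its default value 0 and agrees with the nonnegative integral.\<close>

lemma
  assumes "prob_space \<nu>" "sets \<nu> = sets borel"
  shows nn_integral_Psi: "(\<integral>\<^sup>+x. ennreal (Psi \<alpha> (u * x)) \<partial>\<nu>) = ennreal (G_fun \<alpha> \<nu> (1 / u))"
    and G_fun_nonneg: "0 \<le> G_fun \<alpha> \<nu> (1 / u)"
    and G_fun_le_1: "G_fun \<alpha> \<nu> (1 / u) \<le> 1"
proof -
  interpret prob_space \<nu> by fact
  have [measurable_cong]: "sets \<nu> = sets borel" by fact
  have int: "integrable \<nu> (\<lambda>x. Psi \<alpha> (u * x))"
    by (rule integrable_const_bound[where B = 1]) (auto simp: Psi_le_1)
  then show "(\<integral>\<^sup>+x. ennreal (Psi \<alpha> (u * x)) \<partial>\<nu>) = ennreal (G_fun \<alpha> \<nu> (1 / u))"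
    unfolding G_fun_inverse by (intro nn_integral_eq_integral) auto
  show "0 \<le> G_fun \<alpha> \<nu> (1 / u)" unfolding G_fun_inverse by (rule Bochner_Integration.integral_nonneg) simp
  show "G_fun \<alpha> \<nu> (1 / u) \<le> 1"
    unfolding G_fun_inverse using int by (intro integral_le_const) (auto simp: Psi_le_1)
qed

text \<open>The kernel identity holds for almost every \<open>y\<close>, as \<open>\<nu>\<close> has
  no atom at 0; integrating it over \<open>y\<close> replaces \<open>Psi \<alpha> (u * y)\<close> by
  \<open>G_fun\<close>. The start \<open>x\<close> is arbitrary, so the first step from 0 is
  included.\<close>

lemma nn_integral_Psi_kendall_step_half:
  assumes "\<alpha> > 0" "symmetric_law \<nu>" "measure \<nu> {..<0} = 1 / 2" "0 \<le> u" "S = {0<..} \<or> S = {..0}"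
  shows "(\<integral>\<^sup>+z. ennreal (Psi \<alpha> (u * z)) * indicator S z \<partial>kendall_conv \<alpha> (return borel x) \<nu>)
    = ennreal (G_fun \<alpha> \<nu> (1 / u) / 2) * ennreal (Psi \<alpha> (u * x))"
proof -
  have [measurable]: "S \<in> sets borel" using assms(5) by auto
  from assms(2) have \<nu>: "prob_space \<nu>" and s [measurable_cong]: "sets \<nu> = sets borel"
    by (auto simp: symmetric_law_def)
  have kx: "kendall_kernel \<alpha> x \<in> \<nu> \<rightarrow>\<^sub>M subprob_algebra borel"
    using measurable_compose[OF measurable_Pair1'[of x borel borel]
        measurable_prob_algebraD[OF kendall_kernel_measurable[OF assms(1)]]] s
    by (simp cong: measurable_cong_sets)
  have "(\<integral>\<^sup>+z. ennreal (Psi \<alpha> (u * z)) * indicator S z \<partial>kendall_conv \<alpha> (return borel x) \<nu>)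
      = (\<integral>\<^sup>+y. \<integral>\<^sup>+z. ennreal (Psi \<alpha> (u * z)) * indicator S z \<partial>kendall_kernel \<alpha> x y \<partial>\<nu>)"
    unfolding kendall_conv_return[OF assms(1) \<nu> s] by (rule nn_integral_bind[OF _ kx]) measurable
  also have "\<dots> = (\<integral>\<^sup>+y. ennreal (Psi \<alpha> (u * x) / 2) * ennreal (Psi \<alpha> (u * y)) \<partial>\<nu>)"
    using AE_symmetric_law_nonzero[OF assms(2,3)]
    by (intro nn_integral_cong_AE)
      (auto simp: nn_integral_Psi_kendall_kernel_half[OF assms(1,4) _ assms(5)] simp flip: ennreal_mult'
        elim!: eventually_mono)
  also have "\<dots> = ennreal (Psi \<alpha> (u * x) / 2) * ennreal (G_fun \<alpha> \<nu> (1 / u))"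
    by (simp add: nn_integral_cmult nn_integral_Psi[OF \<nu> s])
  also have "\<dots> = ennreal (G_fun \<alpha> \<nu> (1 / u) / 2) * ennreal (Psi \<alpha> (u * x))"
    using G_fun_nonneg[OF \<nu> s] by (simp add: mult.commute flip: ennreal_mult')
  finally show ?thesis .
qed

section \<open>Disintegration over an event and integration of series\<close>

text \<open>The hypothesis \<open>eq\<close> states that, under \<open>M\<close> restricted to
  \<open>D\<close>, the image law of \<open>X\<close> and the average of \<open>K\<close> agree on
  Borel sets. They are then equal as measures and give the same integral to every \<open>f\<close>.
  This serves both the transition kernel and, with a constant kernel, independence.\<close>

lemma (in finite_measure) nn_integral_disintegrate:
  fixes X :: "'a \<Rightarrow> real"
  assumes [measurable]: "X \<in> borel_measurable M" "D \<in> sets M"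
    and K: "K \<in> M \<rightarrow>\<^sub>M subprob_algebra borel"
    and eq: "\<And>A. A \<in> sets borel \<Longrightarrow>
      emeasure M (D \<inter> (X -` A \<inter> space M)) = (\<integral>\<^sup>+\<omega>. indicator D \<omega> * emeasure (K \<omega>) A \<partial>M)"
    and f: "f \<in> borel_measurable borel"
  shows "(\<integral>\<^sup>+\<omega>. f (X \<omega>) * indicator D \<omega> \<partial>M) = (\<integral>\<^sup>+\<omega>. (\<integral>\<^sup>+z. f z \<partial>K \<omega>) * indicator D \<omega> \<partial>M)"
proof (cases "space M = {}")
  \<comment> \<open>Over an empty space \<open>bind\<close> has a default value, so this case is
    treated apart.\<close>
  case True
  then show ?thesis by (simp add: nn_integral_empty)
next
  case False
  let ?D = "density M (indicator D)"
  have K': "K \<in> ?D \<rightarrow>\<^sub>M subprob_algebra borel" using K by simp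
  have X': "X \<in> borel_measurable ?D" by simp
  have "distr ?D borel X = ?D \<bind> K"
  proof (rule measure_eqI)
    show "sets (distr ?D borel X) = sets (?D \<bind> K)"
      using sets_bind[of ?D K borel] sets_kernel[OF K'] False by simp
    fix A assume "A \<in> sets (distr ?D borel X)"
    then have A [measurable]: "A \<in> sets borel" by simp
    have "emeasure (distr ?D borel X) A = emeasure ?D (X -` A \<inter> space M)"
      by (simp add: emeasure_distr)
    also have "\<dots> = (\<integral>\<^sup>+\<omega>. indicator D \<omega> * indicator (X -` A \<inter> space M) \<omega> \<partial>M)"
      by (rule emeasure_density) measurable
    also have "\<dots> = emeasure M (D \<inter> (X -` A \<inter> space M))"
      by (simp flip: indicator_inter_arith)
    also have "\<dots> = (\<integral>\<^sup>+\<omega>. indicator D \<omega> * emeasure (K \<omega>) A \<partial>M)" by (rule eq[OF A])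
    also have "\<dots> = (\<integral>\<^sup>+\<omega>. emeasure (K \<omega>) A \<partial>?D)"
      by (rule nn_integral_density[symmetric]) (use measurable_emeasure_kernel[OF K A] in auto)
    also have "\<dots> = emeasure (?D \<bind> K) A"
      using False by (intro emeasure_bind[OF _ K' A, symmetric]) simp
    finally show "emeasure (distr ?D borel X) A = emeasure (?D \<bind> K) A" .
  qed
  then have "(\<integral>\<^sup>+z. f z \<partial>distr ?D borel X) = (\<integral>\<^sup>+z. f z \<partial>(?D \<bind> K))" by simp
  also have "(\<integral>\<^sup>+z. f z \<partial>distr ?D borel X) = (\<integral>\<^sup>+\<omega>. f (X \<omega>) \<partial>?D)"
    by (rule nn_integral_distr[OF X']) (use f in simp)
  also have "\<dots> = (\<integral>\<^sup>+\<omega>. indicator D \<omega> * f (X \<omega>) \<partial>M)"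
    by (rule nn_integral_density) (use f in measurable)
  also have "(\<integral>\<^sup>+z. f z \<partial>(?D \<bind> K)) = (\<integral>\<^sup>+\<omega>. \<integral>\<^sup>+z. f z \<partial>K \<omega> \<partial>?D)"
    by (rule nn_integral_bind[OF f K'])
  also have "\<dots> = (\<integral>\<^sup>+\<omega>. indicator D \<omega> * (\<integral>\<^sup>+z. f z \<partial>K \<omega>) \<partial>M)"
    by (rule nn_integral_density)
      (use measurable_compose[OF K nn_integral_measurable_subprob_algebra[OF f]] in auto)
  finally show ?thesis by (simp add: mult.commute)
qed

text \<open>The terms are nonnegative, so sum and integral may be interchanged in
  \<open>ennreal\<close>; the finite sum \<open>C\<close> then brings the result back to the real
  integral.\<close>

lemma integral_eq_sums:
  fixes f :: "'a \<Rightarrow> real"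
  assumes "\<And>n. F n \<in> borel_measurable M" "\<And>n \<omega>. 0 \<le> F n \<omega>"
    and sums: "\<And>\<omega>. \<omega> \<in> space M \<Longrightarrow> (\<lambda>n. F n \<omega>) sums f \<omega>"
    and F: "\<And>n. (\<integral>\<^sup>+\<omega>. ennreal (F n \<omega>) \<partial>M) = ennreal (c n)" "\<And>n. 0 \<le> c n" "c sums C"
  shows "(LINT \<omega>|M. f \<omega>) = C"
proof -
  have f: "f \<omega> = (\<Sum>n. F n \<omega>)" if "\<omega> \<in> space M" for \<omega>
    using sums_unique[OF sums[OF that]] .
  have [measurable]: "f \<in> borel_measurable M"
    using assms(1) by (subst measurable_cong[OF f]) auto
  have nn: "0 \<le> f \<omega>" if "\<omega> \<in> space M" for \<omega>
    using sums[OF that] assms(2) by (metis f[OF that] suminf_nonneg sums_summable)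
  have "(\<integral>\<^sup>+\<omega>. ennreal (f \<omega>) \<partial>M) = (\<integral>\<^sup>+\<omega>. (\<Sum>n. ennreal (F n \<omega>)) \<partial>M)"
    by (intro nn_integral_cong suminf_ennreal_eq[symmetric] assms(2) sums)
  also have "\<dots> = (\<Sum>n. ennreal (c n))"
    using assms(1) by (subst nn_integral_suminf) (auto simp: F(1))
  also have "\<dots> = ennreal C" using F(2,3) by (rule suminf_ennreal_eq)
  finally have "(\<integral>\<^sup>+\<omega>. ennreal (f \<omega>) \<partial>M) = ennreal C" .
  moreover have "0 \<le> C" using F(2,3) by (metis sums_iff suminf_nonneg)
  ultimately show ?thesis using nn by (subst integral_eq_nn_integral) auto
qed

section \<open>The ladder epoch in terms of the path\<close>

text \<open>A finite infimum in \<open>enat\<close> comes from a non-empty set and is attained by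
  well-ordering, so it is the first positive time.\<close>

lemma tau_plus_eq_Suc_iff:
  "tau_plus X \<omega> = enat (Suc n) \<longleftrightarrow> (\<forall>i\<in>{1..n}. X i \<omega> \<le> 0) \<and> 0 < X (Suc n) \<omega>"
proof -
  let ?T = "{enat n | n. n \<ge> 1 \<and> X n \<omega> > 0}"
  show ?thesis
  proof (intro iffI conjI ballI)
    assume tau: "tau_plus X \<omega> = enat (Suc n)"
    have "?T \<noteq> {}"
    proof
      assume empty: "?T = {}"
      have "tau_plus X \<omega> = \<infinity>" unfolding tau_plus_def empty by (simp add: top_enat_def)
      with tau show False by simp
    qed
    then have "Inf ?T \<in> ?T" by (metis (no_types, lifting) ex_in_conv wellorder_InfI)
    then show "0 < X (Suc n) \<omega>" using tau by (auto simp: tau_plus_def)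
    fix i assume i: "i \<in> {1..n}"
    show "X i \<omega> \<le> 0"
    proof (rule ccontr)
      assume "\<not> X i \<omega> \<le> 0"
      then have "Inf ?T \<le> enat i" using i by (intro Inf_lower) auto
      then show False using tau i by (auto simp: tau_plus_def)
    qed
  next
    assume *: "(\<forall>i\<in>{1..n}. X i \<omega> \<le> 0) \<and> 0 < X (Suc n) \<omega>"
    show "tau_plus X \<omega> = enat (Suc n)"
      unfolding tau_plus_def
    proof (rule antisym)
      show "Inf ?T \<le> enat (Suc n)" using * by (intro Inf_lower) auto
      show "enat (Suc n) \<le> Inf ?T"
      proof (rule Inf_greatest)
        fix t assume "t \<in> ?T"
        then obtain i where i: "t = enat i" "1 \<le> i" "0 < X i \<omega>" by auto
        then have "i \<notin> {1..n}" using * by (meson not_less)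
        with i show "enat (Suc n) \<le> t" by simp
      qed
    qed
  qed
qed

lemma tau_plus_nonzero: "tau_plus X \<omega> \<noteq> enat 0"
proof -
  have "enat 1 \<le> tau_plus X \<omega>" unfolding tau_plus_def by (intro Inf_greatest) auto
  then show ?thesis by auto
qed

section \<open>The walk and its one-step transition\<close>

text \<open>The assumption \<open>half\<close> is F(0) = 1/2, since F(t) is the mass of the open
  half-line below t.\<close>

locale symmetric_kendall_walk = prob_space M
  for \<alpha> :: real and \<nu> :: "real measure" and M :: "'w measure" and X :: "nat \<Rightarrow> 'w \<Rightarrow> real" +
  assumes alpha_pos: "\<alpha> > 0"
    and sym: "symmetric_law \<nu>"
    and half: "measure \<nu> {..<0} = 1 / 2"
    and walk: "kendall_walk \<alpha> \<nu> M X"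
begin

lemma prob_space_step: "prob_space \<nu>" and sets_step: "sets \<nu> = sets borel"
  using sym by (auto simp: symmetric_law_def)

lemma X_measurable [measurable]: "X n \<in> borel_measurable M"
  using walk by (simp add: kendall_walk_def)

lemma X_0: "\<omega> \<in> space M \<Longrightarrow> X 0 \<omega> = 0"
  using walk by (simp add: kendall_walk_def)

lemma space_process_sigma: "space (process_sigma M X I) = space M"
  unfolding process_sigma_def by (rule space_measure_of) auto

lemma sets_process_sigma:
  "sets (process_sigma M X I) = sigma_sets (space M) (\<Union>i\<in>I. {X i -` A \<inter> space M | A. A \<in> sets borel})"
  unfolding process_sigma_def by (rule sets_measure_of) auto

lemma sets_process_sigma_subset: "sets (process_sigma M X I) \<subseteq> sets M"
  unfolding sets_process_sigma by (rule sets.sigma_sets_subset) auto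

lemma X_measurable_process_sigma: "i \<in> I \<Longrightarrow> X i \<in> borel_measurable (process_sigma M X I)"
  by (rule measurableI) (auto simp: space_process_sigma sets_process_sigma)

lemma sigma_finite_subalgebra_process_sigma: "sigma_finite_subalgebra M (process_sigma M X I)"
proof -
  have sub: "subalgebra M (process_sigma M X I)"
    using sets_process_sigma_subset by (simp add: subalgebra_def space_process_sigma)
  then show ?thesis
    by (intro finite_measure_subalgebra_is_sigma_finite)
      (simp add: finite_measure_subalgebra_def finite_measure_subalgebra_axioms_def finite_measure_axioms)
qed

abbreviation step_kernel :: "real \<Rightarrow> real measure" where
  "step_kernel x \<equiv> kendall_conv \<alpha> (return borel x) \<nu>"

lemma step_kernel_measurable: "step_kernel \<in> borel \<rightarrow>\<^sub>M prob_algebra borel"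
proof -
  have "(\<lambda>x. \<nu> \<bind> kendall_kernel \<alpha> x) \<in> borel \<rightarrow>\<^sub>M prob_algebra borel"
    using kendall_kernel_measurable[OF alpha_pos] prob_space_step sets_step
    by (intro measurable_bind_prob_space2[where N = borel])
      (auto simp: space_prob_algebra case_prod_beta')
  then show ?thesis
    by (simp add: kendall_conv_return[OF alpha_pos prob_space_step sets_step])
qed

lemma step_kernel_X_measurable: "(\<lambda>\<omega>. step_kernel (X k \<omega>)) \<in> M \<rightarrow>\<^sub>M subprob_algebra borel"
  by (rule measurable_compose[OF X_measurable measurable_prob_algebraD[OF step_kernel_measurable]])

text \<open>Since \<open>D\<close> belongs to the past up to time \<open>k\<close>, integrating the
  conditional probability over \<open>D\<close> gives the joint probability with \<open>D\<close>.
  That is the hypothesis on events in \<open>nn_integral_disintegrate\<close>.\<close>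

lemma nn_integral_transition:
  assumes D: "D \<in> sets (process_sigma M X {..k})" and f: "f \<in> borel_measurable borel"
  shows "(\<integral>\<^sup>+\<omega>. f (X (Suc k) \<omega>) * indicator D \<omega> \<partial>M)
    = (\<integral>\<^sup>+\<omega>. (\<integral>\<^sup>+z. f z \<partial>step_kernel (X k \<omega>)) * indicator D \<omega> \<partial>M)"
proof (rule nn_integral_disintegrate[OF X_measurable _ step_kernel_X_measurable _ f])
  show DM [measurable]: "D \<in> sets M" using D sets_process_sigma_subset by auto
  interpret C: sigma_finite_subalgebra M "process_sigma M X {..k}"
    by (rule sigma_finite_subalgebra_process_sigma)
  fix A :: "real set" assume A [measurable]: "A \<in> sets borel"
  let ?B = "X (Suc k) -` A \<inter> space M"
  let ?K = "\<lambda>\<omega>. step_kernel (X k \<omega>)"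
  have B [measurable]: "?B \<in> sets M" by simp
  interpret K: prob_space "?K \<omega>" for \<omega>
    using measurable_space[OF step_kernel_measurable, of "X k \<omega>"] by (simp add: space_prob_algebra)
  have meas [measurable]: "(\<lambda>\<omega>. measure (?K \<omega>) A) \<in> borel_measurable M"
    using measurable_emeasure_kernel[OF step_kernel_X_measurable[of k] A]
    unfolding measure_def by measurable
  \<comment> \<open>The transition law is used for \<open>n = 1\<close> only, where
    \<open>kendall_power\<close> is \<open>\<nu>\<close> itself.\<close>
  have cond: "AE \<omega> in M. real_cond_exp M (process_sigma M X {..k}) (indicator ?B) \<omega> = measure (?K \<omega>) A"
    using walk[unfolded kendall_walk_def, THEN conjunct2, THEN conjunct2, THEN conjunct2,
        rule_format, of 1 A k] A by simp
  have "measure M (D \<inter> ?B) = (LINT \<omega>:D|M. indicator ?B \<omega>)"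
    by (simp add: set_lebesgue_integral_def flip: indicator_inter_arith)
  also have "\<dots> = (LINT \<omega>:D|M. real_cond_exp M (process_sigma M X {..k}) (indicator ?B) \<omega>)"
    by (rule C.real_cond_exp_intA[OF _ D]) (simp add: integrable_indicator_iff less_top[symmetric])
  also have "\<dots> = (LINT \<omega>|M. indicator D \<omega> * measure (?K \<omega>) A)"
    unfolding set_lebesgue_integral_def
    by (rule integral_cong_AE) (use cond in \<open>auto elim!: eventually_mono\<close>)
  finally have eq: "measure M (D \<inter> ?B) = (LINT \<omega>|M. indicator D \<omega> * measure (?K \<omega>) A)" .
  have "integrable M (\<lambda>\<omega>. indicator D \<omega> * measure (?K \<omega>) A)"
    by (rule integrable_const_bound[where B = 1]) (auto simp: indicator_def)
  then have "(\<integral>\<^sup>+\<omega>. ennreal (indicator D \<omega> * measure (?K \<omega>) A) \<partial>M) = ennreal (measure M (D \<inter> ?B))"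
    unfolding eq by (rule nn_integral_eq_integral) simp
  then show "emeasure M (D \<inter> ?B) = (\<integral>\<^sup>+\<omega>. indicator D \<omega> * emeasure (?K \<omega>) A \<partial>M)"
    by (simp add: emeasure_eq_measure K.emeasure_eq_measure ennreal_mult' ennreal_indicator)
qed

text \<open>The inner integral of the transition is a constant times
  \<open>Psi \<alpha> (u * X k \<omega>)\<close>, so the constant can be pulled out. The choice
  \<open>{..0}\<close> describes a step that continues and \<open>{0<..}\<close> one that
  stops.\<close>

lemma nn_integral_Psi_step_half:
  assumes "0 \<le> u" "S = {0<..} \<or> S = {..0}" and D: "D \<in> sets (process_sigma M X {..k})"
  shows "(\<integral>\<^sup>+\<omega>. ennreal (Psi \<alpha> (u * X (Suc k) \<omega>)) * indicator S (X (Suc k) \<omega>) * indicator D \<omega> \<partial>M)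
    = ennreal (G_fun \<alpha> \<nu> (1 / u) / 2) * (\<integral>\<^sup>+\<omega>. ennreal (Psi \<alpha> (u * X k \<omega>)) * indicator D \<omega> \<partial>M)"
proof -
  have [measurable]: "S \<in> sets borel" "D \<in> sets M"
    using assms(2) D sets_process_sigma_subset by auto
  show ?thesis
    by (subst nn_integral_transition[OF D])
      (simp_all add: nn_integral_Psi_kendall_step_half[OF alpha_pos sym half assms(1,2)]
        nn_integral_cmult mult.assoc)
qed

section \<open>The joint transform of the ladder epoch and the position there\<close>

text \<open>This is the event that the ladder epoch exceeds \<open>n\<close>; for
  \<open>n = 0\<close> it is the whole space.\<close>

definition nonpos_until :: "nat \<Rightarrow> 'w set" where
  "nonpos_until n = {\<omega>\<in>space M. \<forall>i\<in>{1..n}. X i \<omega> \<le> 0}"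

lemma nonpos_until_sets: "nonpos_until n \<in> sets (process_sigma M X {..n})"
proof -
  have "nonpos_until n = {\<omega>\<in>space (process_sigma M X {..n}). \<forall>i\<in>{1..n}. X i \<omega> \<le> 0}"
    by (simp add: nonpos_until_def space_process_sigma)
  also have "\<dots> \<in> sets (process_sigma M X {..n})"
    by (intro sets.sets_Collect_finite_All' sets.sets_Collect_finite_All borel_measurable_le
        X_measurable_process_sigma borel_measurable_const) auto
  finally show ?thesis .
qed

lemma nonpos_until_sets_M [measurable]: "nonpos_until n \<in> sets M"
  using nonpos_until_sets sets_process_sigma_subset by blast

lemma nn_integral_Psi_nonpos_until:
  assumes "0 \<le> u"
  shows "(\<integral>\<^sup>+\<omega>. ennreal (Psi \<alpha> (u * X n \<omega>)) * indicator (nonpos_until n) \<omega> \<partial>M)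
    = ennreal ((G_fun \<alpha> \<nu> (1 / u) / 2) ^ n)"
proof (induction n)
  case 0
  have "(\<integral>\<^sup>+\<omega>. ennreal (Psi \<alpha> (u * X 0 \<omega>)) * indicator (nonpos_until 0) \<omega> \<partial>M) = (\<integral>\<^sup>+\<omega>. 1 \<partial>M)"
    by (intro nn_integral_cong) (simp add: X_0 nonpos_until_def)
  then show ?case by (simp add: emeasure_space_1)
next
  case (Suc n)
  \<comment> \<open>The event splits into the past event and the sign of the new position, which is
    the shape of \<open>nn_integral_Psi_step_half\<close> with \<open>S = {..0}\<close>.\<close>
  have "indicator (nonpos_until (Suc n)) \<omega>
      = (indicator {..0} (X (Suc n) \<omega>) * indicator (nonpos_until n) \<omega> :: ennreal)" for \<omega>
    by (auto simp: nonpos_until_def indicator_def atLeastAtMostSuc_conv)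
  then have "(\<integral>\<^sup>+\<omega>. ennreal (Psi \<alpha> (u * X (Suc n) \<omega>)) * indicator (nonpos_until (Suc n)) \<omega> \<partial>M)
      = (\<integral>\<^sup>+\<omega>. ennreal (Psi \<alpha> (u * X (Suc n) \<omega>)) * indicator {..0} (X (Suc n) \<omega>)
          * indicator (nonpos_until n) \<omega> \<partial>M)"
    by (simp add: mult.assoc)
  also have "\<dots> = ennreal (G_fun \<alpha> \<nu> (1 / u) / 2) * ennreal ((G_fun \<alpha> \<nu> (1 / u) / 2) ^ n)"
    using assms by (subst nn_integral_Psi_step_half[OF _ _ nonpos_until_sets]) (auto simp: Suc)
  also have "\<dots> = ennreal ((G_fun \<alpha> \<nu> (1 / u) / 2) ^ Suc n)"
    using G_fun_nonneg[OF prob_space_step sets_step] by (simp flip: ennreal_mult')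
  finally show ?case .
qed

text \<open>Without a sign condition both half-lines contribute, half of \<open>G_fun\<close> each,
  so every step multiplies by the full value.\<close>

lemma nn_integral_Psi_X:
  assumes "0 \<le> u"
  shows "(\<integral>\<^sup>+\<omega>. ennreal (Psi \<alpha> (u * X n \<omega>)) \<partial>M) = ennreal (G_fun \<alpha> \<nu> (1 / u) ^ n)"
proof (induction n)
  case 0
  have "(\<integral>\<^sup>+\<omega>. ennreal (Psi \<alpha> (u * X 0 \<omega>)) \<partial>M) = (\<integral>\<^sup>+\<omega>. 1 \<partial>M)"
    by (intro nn_integral_cong) (simp add: X_0)
  then show ?case by (simp add: emeasure_space_1)
next
  case (Suc n)
  let ?g = "G_fun \<alpha> \<nu> (1 / u)"
  let ?P = "\<lambda>\<omega>. ennreal (Psi \<alpha> (u * X (Suc n) \<omega>))"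
  let ?J = "\<lambda>S. \<integral>\<^sup>+\<omega>. ?P \<omega> * indicator S (X (Suc n) \<omega>) * indicator (space M) \<omega> \<partial>M"
  have g: "0 \<le> ?g" by (rule G_fun_nonneg[OF prob_space_step sets_step])
  \<comment> \<open>Taking the whole space as past event imposes no condition on the path.\<close>
  have D: "space M \<in> sets (process_sigma M X {..n})"
    by (metis sets.top space_process_sigma)
  have "(\<integral>\<^sup>+\<omega>. ennreal (Psi \<alpha> (u * X n \<omega>)) * indicator (space M) \<omega> \<partial>M) = ennreal (?g ^ n)"
    unfolding Suc[symmetric] by (rule nn_integral_cong) simp
  then have J: "?J S = ennreal (?g / 2 * ?g ^ n)" if "S = {0<..} \<or> S = {..0}" for S
    using nn_integral_Psi_step_half[OF assms that D] g by (subst ennreal_mult) simp_all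
  have "(\<integral>\<^sup>+\<omega>. ?P \<omega> \<partial>M) = (\<integral>\<^sup>+\<omega>. (?P \<omega> * indicator {0<..} (X (Suc n) \<omega>) * indicator (space M) \<omega>
      + ?P \<omega> * indicator {..0} (X (Suc n) \<omega>) * indicator (space M) \<omega>) \<partial>M)"
    by (rule nn_integral_cong) (auto simp: indicator_def)
  also have "\<dots> = ?J {0<..} + ?J {..0}" by (rule nn_integral_add) measurable
  also have "\<dots> = ennreal (?g ^ Suc n)"
    unfolding J[OF disjI1[OF refl]] J[OF disjI2[OF refl]] using g by (simp flip: ennreal_plus)
  finally show ?case .
qed

text \<open>The summand with index \<open>n\<close> is non-zero only if the epoch is
  \<open>Suc n\<close>, so at most one survives. If the epoch is infinite, all vanish, in agreement
  with the value 0 of \<open>enat_pow\<close>.\<close>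

lemma sums_at_tau_plus:
  assumes "\<omega> \<in> space M"
  shows "(\<lambda>n. s ^ Suc n * (Psi \<alpha> (u * X (Suc n) \<omega>) * indicator {0<..} (X (Suc n) \<omega>)
      * indicator (nonpos_until n) \<omega>)) sums (enat_pow s (tau_plus X \<omega>) * Psi \<alpha> (u * X_tau X \<omega>))"
    (is "?F sums ?f")
proof -
  have F: "?F n = (if tau_plus X \<omega> = enat (Suc n) then ?f else 0)" for n
  proof (cases "tau_plus X \<omega> = enat (Suc n)")
    case True
    then have "\<omega> \<in> nonpos_until n" "0 < X (Suc n) \<omega>"
      using assms by (simp_all add: tau_plus_eq_Suc_iff nonpos_until_def)
    then show ?thesis using True by (simp add: X_tau_def enat_pow_def)
  next
    case False
    then have "\<omega> \<notin> nonpos_until n \<or> \<not> 0 < X (Suc n) \<omega>"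
      by (simp add: tau_plus_eq_Suc_iff nonpos_until_def)
    then show ?thesis using False by auto
  qed
  show ?thesis
  proof (cases "tau_plus X \<omega>")
    case (enat m)
    then obtain k where k: "m = Suc k" using tau_plus_nonzero[of X \<omega>] by (cases m) auto
    have "?F = (\<lambda>n. if n = k then ?f else 0)"
      unfolding F using enat k by auto
    then show ?thesis using sums_single[of k "\<lambda>_. ?f"] by simp
  next
    case infinity
    then have "?F = (\<lambda>n. 0)" and "?f = 0" unfolding F by (auto simp: enat_pow_def)
    then show ?thesis by (simp only: sums_zero)
  qed
qed

text \<open>The epoch \<open>Suc n\<close> consists of \<open>n\<close> continuing steps and one
  stopping step, each with factor \<open>g / 2\<close>, which gives a geometric series without its
  constant term.\<close>

lemma integral_Psi_tau_plus:
  assumes "0 \<le> s" "s \<le> 1" "0 \<le> u"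
  defines "g \<equiv> G_fun \<alpha> \<nu> (1 / u)"
  shows "(LINT \<omega>|M. enat_pow s (tau_plus X \<omega>) * Psi \<alpha> (u * X_tau X \<omega>)) = (s * g / 2) / (1 - s * g / 2)"
proof (rule integral_eq_sums[OF _ _ sums_at_tau_plus])
  have g: "0 \<le> g" "g \<le> 1"
    unfolding g_def using prob_space_step sets_step by (rule G_fun_nonneg G_fun_le_1)+
  let ?F = "\<lambda>n \<omega>. Psi \<alpha> (u * X (Suc n) \<omega>) * indicator {0<..} (X (Suc n) \<omega>) * indicator (nonpos_until n) \<omega>"
  show "(\<lambda>\<omega>. s ^ Suc n * ?F n \<omega>) \<in> borel_measurable M" for n by measurable
  show "0 \<le> s ^ Suc n * ?F n \<omega>" for n \<omega> using assms(1) by simp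
  show "(\<integral>\<^sup>+\<omega>. ennreal (s ^ Suc n * ?F n \<omega>) \<partial>M) = ennreal ((s * g / 2) ^ Suc n)" for n
  proof -
    have "(\<integral>\<^sup>+\<omega>. ennreal (s ^ Suc n * ?F n \<omega>) \<partial>M) = ennreal (s ^ Suc n) *
        (\<integral>\<^sup>+\<omega>. ennreal (Psi \<alpha> (u * X (Suc n) \<omega>)) * indicator {0<..} (X (Suc n) \<omega>)
          * indicator (nonpos_until n) \<omega> \<partial>M)"
      using assms(1)
      by (subst nn_integral_cmult[symmetric])
        (auto simp: ennreal_mult' ennreal_indicator simp del: power_Suc intro!: nn_integral_cong)
    also have "\<dots> = ennreal (s ^ Suc n) * (ennreal (g / 2) * ennreal ((g / 2) ^ n))"
      using assms(3) by (subst nn_integral_Psi_step_half[OF _ _ nonpos_until_sets])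
        (auto simp: nn_integral_Psi_nonpos_until g_def)
    also have "\<dots> = ennreal (s ^ Suc n * (g / 2 * (g / 2) ^ n))"
      using assms(1) g
      by (simp only: ennreal_mult zero_le_power mult_nonneg_nonneg divide_nonneg_pos zero_less_numeral)
    also have "s ^ Suc n * (g / 2 * (g / 2) ^ n) = (s * g / 2) ^ Suc n"
      by (simp add: power_mult_distrib power_divide)
    finally show ?thesis .
  qed
  show "0 \<le> (s * g / 2) ^ Suc n" for n using assms(1) g by simp
  \<comment> \<open>The ratio is at most \<open>1 / 2\<close>, so the series converges for
    \<open>s = 1\<close> too.\<close>
  have "s * g \<le> 1" using assms(1,2) g by (simp add: mult_le_one)
  then have "norm (s * g / 2) < 1" using assms(1) g by (simp add: abs_mult)
  from sums_mult[OF geometric_sums[OF this], of "s * g / 2"]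
  show "(\<lambda>n. (s * g / 2) ^ Suc n) sums ((s * g / 2) / (1 - s * g / 2))" by simp
qed

text \<open>For \<open>u = 0\<close> the factor \<open>Psi\<close> is constantly 1 and
  \<open>G_fun\<close> becomes the total mass of \<open>\<nu>\<close>.\<close>

lemma integral_enat_pow_tau_plus:
  assumes "0 \<le> s" "s \<le> 1"
  shows "(LINT \<omega>|M. enat_pow s (tau_plus X \<omega>)) = (s / 2) / (1 - s / 2)"
proof -
  interpret \<nu>: prob_space \<nu> by (rule prob_space_step)
  have "G_fun \<alpha> \<nu> (1 / 0) = 1" unfolding G_fun_inverse by (simp add: \<nu>.prob_space)
  then show ?thesis using integral_Psi_tau_plus[OF assms, of 0] by simp
qed

section \<open>The geometric-Kendall variable\<close>

text \<open>\<open>geometric_time\<close> prescribes the masses at \<open>k \<ge> 1\<close> only; as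
  \<open>q < 1\<close>, these already sum to 1.\<close>

lemma geometric_time_zero:
  assumes "geometric_time q M X N" "0 \<le> q" "q < 1"
  shows "prob {\<omega>\<in>space M. N \<omega> = 0} = 0"
proof -
  have N [measurable]: "N \<in> M \<rightarrow>\<^sub>M count_space UNIV"
    and p: "prob {\<omega>\<in>space M. N \<omega> = Suc k} = q ^ k * (1 - q)" for k
    using assms(1) by (auto simp: geometric_time_def)
  let ?E = "\<lambda>k. {\<omega>\<in>space M. N \<omega> = k}"
  have "(\<lambda>k. prob (?E k)) sums prob (\<Union>k. ?E k)"
    by (rule finite_measure_UNION) (auto simp: disjoint_family_on_def)
  moreover have "(\<Union>k. ?E k) = space M" by auto
  ultimately have "(\<lambda>k. prob (?E k)) sums 1" by (simp add: prob_space)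
  then have "(\<lambda>k. prob (?E (Suc k))) sums (1 - prob (?E 0))"
    using sums_Suc_iff[of "\<lambda>k. prob (?E k)" "1 - prob (?E 0)"] by simp
  moreover have "(\<lambda>k. prob (?E (Suc k))) sums 1"
    using sums_mult2[OF geometric_sums[of q], of "1 - q"] assms(2,3) by (simp add: p)
  ultimately show ?thesis using sums_unique2 by fastforce
qed

text \<open>Independence is disintegration over the event that \<open>N\<close> equals
  \<open>k\<close>, with the law of \<open>X k\<close> as constant kernel.\<close>

lemma nn_integral_Psi_geometric_time:
  assumes "geometric_time q M X N" "0 \<le> u"
  shows "(\<integral>\<^sup>+\<omega>. ennreal (Psi \<alpha> (u * X k \<omega>)) * indicator {\<omega>\<in>space M. N \<omega> = k} \<omega> \<partial>M)
    = ennreal (prob {\<omega>\<in>space M. N \<omega> = k} * G_fun \<alpha> \<nu> (1 / u) ^ k)"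
proof -
  let ?E = "{\<omega>\<in>space M. N \<omega> = k}" and ?K = "\<lambda>_::'w. distr M borel (X k)"
  have N [measurable]: "N \<in> M \<rightarrow>\<^sub>M count_space UNIV"
    and ind: "indep_set (sets (vimage_algebra (space M) N (count_space UNIV)))
       (sets (process_sigma M X UNIV))"
    using assms(1) by (auto simp: geometric_time_def)
  have E: "?E \<in> sets M" by measurable
  have K: "?K \<in> M \<rightarrow>\<^sub>M subprob_algebra borel"
    by (rule measurable_const)
      (auto simp: space_subprob_algebra intro!: prob_space_imp_subprob_space prob_space_distr)
  have "(\<integral>\<^sup>+\<omega>. ennreal (Psi \<alpha> (u * X k \<omega>)) * indicator ?E \<omega> \<partial>M)
      = (\<integral>\<^sup>+\<omega>. (\<integral>\<^sup>+z. ennreal (Psi \<alpha> (u * z)) \<partial>distr M borel (X k)) * indicator ?E \<omega> \<partial>M)"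
  proof (rule nn_integral_disintegrate[OF X_measurable E K])
    fix A :: "real set" assume A [measurable]: "A \<in> sets borel"
    have "N -` {k} \<inter> space M \<in> sets (vimage_algebra (space M) N (count_space UNIV))"
      by (rule in_vimage_algebra) simp
    moreover have "N -` {k} \<inter> space M = ?E" by auto
    moreover have "X k -` A \<inter> space M \<in> sets (process_sigma M X UNIV)"
      using measurable_sets[OF X_measurable_process_sigma[of k UNIV] A] by (simp add: space_process_sigma)
    ultimately have "prob (?E \<inter> (X k -` A \<inter> space M)) = prob ?E * prob (X k -` A \<inter> space M)"
      using indep_setD[OF ind] by metis
    then show "emeasure M (?E \<inter> (X k -` A \<inter> space M))
        = (\<integral>\<^sup>+\<omega>. indicator ?E \<omega> * emeasure (distr M borel (X k)) A \<partial>M)"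
      using E by (simp add: nn_integral_multc emeasure_distr emeasure_eq_measure ennreal_mult')
  qed measurable
  also have "(\<integral>\<^sup>+z. ennreal (Psi \<alpha> (u * z)) \<partial>distr M borel (X k)) = ennreal (G_fun \<alpha> \<nu> (1 / u) ^ k)"
    using nn_integral_Psi_X[OF assms(2)] by (subst nn_integral_distr) auto
  finally show ?thesis
    using E by (simp add: nn_integral_cmult emeasure_eq_measure ennreal_mult'' mult.commute)
qed

text \<open>At most one summand survives. For \<open>N \<omega> = 0\<close> none does, and the empty
  value 0 agrees with \<open>X 0 \<omega>\<close>.\<close>

lemma geometric_kendall_eq:
  assumes "\<omega> \<in> space M"
  shows "geometric_kendall X N \<omega> = X (N \<omega>) \<omega>"
proof (cases "N \<omega>")
  case 0
  then show ?thesis using assms by (simp add: geometric_kendall_def X_0)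
next
  case (Suc k)
  have "(\<lambda>n. X (Suc n) \<omega> * of_bool (N \<omega> = Suc n)) = (\<lambda>n. if n = k then X (Suc n) \<omega> else 0)"
    using Suc by auto
  then show ?thesis
    using sums_unique[OF sums_single[of k "\<lambda>n. X (Suc n) \<omega>"]] Suc by (simp add: geometric_kendall_def)
qed

text \<open>Splitting by the value \<open>k\<close> of \<open>N\<close> gives the terms
  \<open>q ^ (k - 1) * (1 - q) * g ^ k\<close> for \<open>k \<ge> 1\<close>, again a geometric
  series.\<close>

lemma integral_Psi_geometric_kendall:
  assumes N: "geometric_time q M X N" and "0 \<le> q" "q < 1" "0 \<le> u"
  defines "g \<equiv> G_fun \<alpha> \<nu> (1 / u)"
  shows "(LINT \<omega>|M. Psi \<alpha> (u * geometric_kendall X N \<omega>)) = (1 - q) * g / (1 - q * g)"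
proof (rule integral_eq_sums)
  have g: "0 \<le> g" "g \<le> 1"
    unfolding g_def using prob_space_step sets_step by (rule G_fun_nonneg G_fun_le_1)+
  let ?E = "\<lambda>k. {\<omega>\<in>space M. N \<omega> = k}"
  let ?F = "\<lambda>k \<omega>. Psi \<alpha> (u * X k \<omega>) * indicator (?E k) \<omega>"
  have [measurable]: "N \<in> M \<rightarrow>\<^sub>M count_space UNIV"
    and p: "prob (?E (Suc k)) = q ^ k * (1 - q)" for k
    using N by (auto simp: geometric_time_def)
  show "?F k \<in> borel_measurable M" for k by measurable
  show "0 \<le> ?F k \<omega>" for k \<omega> by simp
  show "(\<lambda>k. ?F k \<omega>) sums Psi \<alpha> (u * geometric_kendall X N \<omega>)" if "\<omega> \<in> space M" for \<omega>
  proof -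
    have "(\<lambda>k. ?F k \<omega>) = (\<lambda>k. if k = N \<omega> then Psi \<alpha> (u * X k \<omega>) else 0)"
      using that by auto
    then show ?thesis
      using sums_single[of "N \<omega>" "\<lambda>k. Psi \<alpha> (u * X k \<omega>)"] that by (simp add: geometric_kendall_eq)
  qed
  show "(\<integral>\<^sup>+\<omega>. ennreal (?F k \<omega>) \<partial>M) = ennreal (prob (?E k) * g ^ k)" for k
    using nn_integral_Psi_geometric_time[OF N assms(4), of k]
    by (simp add: ennreal_mult' ennreal_indicator g_def)
  show "0 \<le> prob (?E k) * g ^ k" for k using g by simp
  have "q * g < 1" using assms(2,3) g by (metis mult_left_le order.strict_trans1)
  then have "norm (q * g) < 1" using assms(2) g by simp
  from sums_mult[OF geometric_sums[OF this], of "(1 - q) * g"]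
  have "(\<lambda>k. prob (?E (Suc k)) * g ^ Suc k) sums ((1 - q) * g / (1 - q * g))"
    by (simp add: p power_mult_distrib mult_ac)
  \<comment> \<open>The series over the values of \<open>N\<close> starts at 0, where the term
    vanishes by \<open>geometric_time_zero\<close>.\<close>
  then show "(\<lambda>k. prob (?E k) * g ^ k) sums ((1 - q) * g / (1 - q * g))"
    using geometric_time_zero[OF N assms(2,3)]
      sums_Suc_iff[of "\<lambda>k. prob (?E k) * g ^ k" "(1 - q) * g / (1 - q * g)"] by simp
qed

end

theorem theorem3p5:
  fixes \<alpha> s u :: real and \<nu> :: "real measure"
    and M :: "'w measure" and X :: "nat \<Rightarrow> 'w \<Rightarrow> real"
  assumes "\<alpha> > 0"
    and "symmetric_law \<nu>"
    and "measure \<nu> {..<0} = 1 / 2"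
    and "kendall_walk \<alpha> \<nu> M X"
    and "0 \<le> s" "s \<le> 1" "u > 0"
  shows "(LINT \<omega>|M. enat_pow s (tau_plus X \<omega>) * Psi \<alpha> (u * X_tau X \<omega>)) =
           (s / 2) / (1 - s / 2) *
           (((1 - s / 2) * G_fun \<alpha> \<nu> (1 / u)) / (1 - s / 2 * G_fun \<alpha> \<nu> (1 / u))) \<and>
         (\<forall>N. geometric_time (s / 2) M X N \<longrightarrow>
           (s / 2) / (1 - s / 2) *
           (((1 - s / 2) * G_fun \<alpha> \<nu> (1 / u)) / (1 - s / 2 * G_fun \<alpha> \<nu> (1 / u))) =
           (LINT \<omega>|M. enat_pow s (tau_plus X \<omega>)) *
           (LINT \<omega>|M. Psi \<alpha> (u * geometric_kendall X N \<omega>)))"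
proof -
  interpret prob_space M using assms(4) by (simp add: kendall_walk_def)
  interpret symmetric_kendall_walk \<alpha> \<nu> M X
    by unfold_locales (fact assms)+
  \<comment> \<open>The factor \<open>1 - s / 2\<close> cancels both in the middle expression and in
    the product of the two expectations, so one rule simplifies both; it is non-zero because
    \<open>s \<le> 1\<close>.\<close>
  have "a / c * ((c * g) / d) = a * g / d" if "c \<noteq> 0" for a c g d :: real
    using that by simp
  moreover have "1 - s / 2 \<noteq> 0" using assms(6) by simp
  ultimately have cancel: "a / (1 - s / 2) * (((1 - s / 2) * g) / d) = a * g / d" for a g d
    by blast
  show ?thesis
    unfolding cancel
  proof (intro conjI allI impI)
    show "(LINT \<omega>|M. enat_pow s (tau_plus X \<omega>) * Psi \<alpha> (u * X_tau X \<omega>)) =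
        s / 2 * G_fun \<alpha> \<nu> (1 / u) / (1 - s / 2 * G_fun \<alpha> \<nu> (1 / u))"
      using integral_Psi_tau_plus[of s u] assms(5-7) by simp
    fix N assume N: "geometric_time (s / 2) M X N"
    have "(LINT \<omega>|M. Psi \<alpha> (u * geometric_kendall X N \<omega>)) =
        (1 - s / 2) * G_fun \<alpha> \<nu> (1 / u) / (1 - s / 2 * G_fun \<alpha> \<nu> (1 / u))"
      using assms(5-7) by (intro integral_Psi_geometric_kendall[OF N]) auto
    then show "s / 2 * G_fun \<alpha> \<nu> (1 / u) / (1 - s / 2 * G_fun \<alpha> \<nu> (1 / u)) =
        (LINT \<omega>|M. enat_pow s (tau_plus X \<omega>)) *
        (LINT \<omega>|M. Psi \<alpha> (u * geometric_kendall X N \<omega>))"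
      by (simp only: integral_enat_pow_tau_plus[OF assms(5,6)] cancel)
  qed
qed

end
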